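(* Let $(X,\mathcal{T})$ be a topological space and let $\mathcal{P}$ be a presheaf of pseudometric spaces on $(X,\mathcal{T})$ whose restrictions $\mathcal{P}(V\subseteq U):\mathcal{P}(U)\to\mathcal{P}(V)$ (for open sets $V\subseteq U$) are Lipschitz continuous functions with Lipschitz constant $K$. If $a\in\prod_{U\in\mathcal{T}}\mathcal{P}(U)$ is an $\epsilon$-approximate section of $\mathcal{P}$, then the distance between $a$ and the nearest global section to $a$ is at least $\frac{\epsilon}{1+K}$; that is, for every global section $s\in\mathcal{P}(X)$, $$D(s,a)\;\ge\;\frac{\epsilon}{1+K}.$$
   Context: A pseudometric on a set $A$ is a function $d:A\times A\to\mathbb{R}$ that is nonnegative, symmetric, satisfies $d(x,x)=0$ and the triangle inequality (distinct points may be at distance $0$). A presheaf of pseudometric spaces $\mathcal{P}$ on a topological space $(X,\mathcal{T})$ assigns to each open set $U\in\mathcal{T}$ a pseudometric space $(\mathcal{P}(U),d_U)$, and to each pair of open sets $V\subseteq U$ a continuous function $\mathcal{P}(V\subseteq U):\mathcal{P}(U)\to\mathcal{P}(V)$, called a restriction, such that $\mathcal{P}(U\subseteq U)$ is the identity and $\mathcal{P}(W\subseteq V)\circ\mathcal{P}(V\subseteq U)=\mathcal{P}(W\subseteq U)$ whenever $W\subseteq V\subseteq U$. An assignment is an element $a$ of the Cartesian product $\prod_{U\in\mathcal{T}}\mathcal{P}(U)$; its component at $U$ is written $a(U)$. A global section is an element $s\in\mathcal{P}(X)$; it is regarded as an assignment by setting $s(U)=\mathcal{P}(U\subseteq X)(s)$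 for $U\in\mathcal{T}$. The distance between assignments $a,b$ is $D(a,b)=\sup_{U\in\mathcal{T}}d_U(a(U),b(U))$. An assignment $a$ is an $\epsilon$-approximate section if $d_V\bigl(a(V),\mathcal{P}(V\subseteq U)a(U)\bigr)\le\epsilon$ for all open $V\subseteq U$. The minimum value of $\epsilon$ for which $a$ is an $\epsilon$-approximate section is called the consistency radius of $a$.
   Formalization: ε is taken to be the consistency radius of a (the minimum ε for which a is an ε-approximate section); for arbitrary ε the claim is false, since a global section is ε-approximate for every ε > 0 but has distance 0 to itself. *)

theory Defs
  imports "HOL-Analysis.Analysis"
begin

locale pseudometric_space =
  fixes M :: "'b set" and d :: "'b \<Rightarrow> 'b \<Rightarrow> real"
  assumes nonneg: "\<lbrakk>x \<in> M; y \<in> M\<rbrakk> \<Longrightarrow> 0 \<le> d x y"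
    and commute: "\<lbrakk>x \<in> M; y \<in> M\<rbrakk> \<Longrightarrow> d x y = d y x"
    and refl: "x \<in> M \<Longrightarrow> d x x = 0"
    and triangle: "\<lbrakk>x \<in> M; y \<in> M; z \<in> M\<rbrakk> \<Longrightarrow> d x z \<le> d x y + d y z"

(* Continuity and Lipschitz continuity of a map from (M, d) to a pseudometric space with
   distance e, relative to the carrier M. As in lipschitz_on, a Lipschitz constant is
   nonnegative. *)

definition pseudometric_continuous ::
    "'b set \<Rightarrow> ('b \<Rightarrow> 'b \<Rightarrow> real) \<Rightarrow> ('c \<Rightarrow> 'c \<Rightarrow> real) \<Rightarrow> ('b \<Rightarrow> 'c) \<Rightarrow> bool" where
  "pseudometric_continuous M d e f \<longleftrightarrow>
     (\<forall>x\<in>M. \<forall>\<epsilon>>0. \<exists>\<delta>>0. \<forall>y\<in>M. d x y < \<delta> \<longrightarrow> e (f x) (f y) < \<epsilon>)"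

definition pseudometric_lipschitz ::
    "real \<Rightarrow> 'b set \<Rightarrow> ('b \<Rightarrow> 'b \<Rightarrow> real) \<Rightarrow> ('c \<Rightarrow> 'c \<Rightarrow> real) \<Rightarrow> ('b \<Rightarrow> 'c) \<Rightarrow> bool" where
  "pseudometric_lipschitz K M d e f \<longleftrightarrow>
     0 \<le> K \<and> (\<forall>x\<in>M. \<forall>y\<in>M. e (f x) (f y) \<le> K * d x y)"

(* The spaces of sections over the various open sets are subsets of one type 'b; a family of
   sets of different types can be embedded into their disjoint sum. restr P V U is the
   restriction from U to V, for V contained in U. The fields are only constrained on open
   sets, and the distances and restrictions only on sections. *)

record ('a, 'b) presheaf_data =
  sections :: "'a set \<Rightarrow> 'b set"
  sdist :: "'a set \<Rightarrow> 'b \<Rightarrow> 'b \<Rightarrow> real"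
  restr :: "'a set \<Rightarrow> 'a set \<Rightarrow> 'b \<Rightarrow> 'b"

locale pseudometric_presheaf =
  fixes X :: "'a topology" and P :: "('a, 'b) presheaf_data"
  assumes pseudometric_space_sections:
      "openin X U \<Longrightarrow> pseudometric_space (sections P U) (sdist P U)"
    and restr_funcset:
      "\<lbrakk>openin X U; openin X V; V \<subseteq> U\<rbrakk> \<Longrightarrow> restr P V U \<in> sections P U \<rightarrow> sections P V"
    and restr_continuous:
      "\<lbrakk>openin X U; openin X V; V \<subseteq> U\<rbrakk>
        \<Longrightarrow> pseudometric_continuous (sections P U) (sdist P U) (sdist P V) (restr P V U)"
    and restr_id:
      "\<lbrakk>openin X U; x \<in> sections P U\<rbrakk> \<Longrightarrow> restr P U U x = x"
    and restr_comp:
      "\<lbrakk>openin X U; openin X V; openin X W; W \<subseteq> V; V \<subseteq> U; x \<in> sections P U\<rbrakk>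
        \<Longrightarrow> restr P W V (restr P V U x) = restr P W U x"

definition assignments :: "'a topology \<Rightarrow> ('a, 'b) presheaf_data \<Rightarrow> ('a set \<Rightarrow> 'b) set" where
  "assignments X P = (\<Pi> U\<in>{U. openin X U}. sections P U)"

definition global_assignment ::
    "'a topology \<Rightarrow> ('a, 'b) presheaf_data \<Rightarrow> 'b \<Rightarrow> 'a set \<Rightarrow> 'b" where
  "global_assignment X P s = (\<lambda>U. restr P U (topspace X) s)"

(* The supremum may be infinite, hence the type ereal. *)

definition assignment_dist ::
    "'a topology \<Rightarrow> ('a, 'b) presheaf_data \<Rightarrow> ('a set \<Rightarrow> 'b) \<Rightarrow> ('a set \<Rightarrow> 'b) \<Rightarrow> ereal" where
  "assignment_dist X P a b = (SUP U\<in>{U. openin X U}. ereal (sdist P U (a U) (b U)))"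

definition approximate_section ::
    "'a topology \<Rightarrow> ('a, 'b) presheaf_data \<Rightarrow> real \<Rightarrow> ('a set \<Rightarrow> 'b) \<Rightarrow> bool" where
  "approximate_section X P \<epsilon> a \<longleftrightarrow>
     (\<forall>U V. openin X U \<longrightarrow> openin X V \<longrightarrow> V \<subseteq> U \<longrightarrow> sdist P V (a V) (restr P V U (a U)) \<le> \<epsilon>)"

definition consistency_radius ::
    "'a topology \<Rightarrow> ('a, 'b) presheaf_data \<Rightarrow> ('a set \<Rightarrow> 'b) \<Rightarrow> real" where
  "consistency_radius X P a = (LEAST \<epsilon>. approximate_section X P \<epsilon> a)"

(* The minimum exists as soon as a is an approximate section for some real bound (LEAST is
   unspecified otherwise). *)

lemma
  assumes "approximate_section X P \<epsilon> a"
  shows approximate_section_consistency_radius: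
      "approximate_section X P (consistency_radius X P a) a"
    and consistency_radius_le: "consistency_radius X P a \<le> \<epsilon>"
proof -
  define S where "S = {sdist P V (a V) (restr P V U (a U)) |U V. openin X U \<and> openin X V \<and> V \<subseteq> U}"
  have S: "approximate_section X P r a \<longleftrightarrow> (\<forall>x\<in>S. x \<le> r)" for r
    unfolding approximate_section_def S_def by blast
  have "S \<noteq> {}"
    unfolding S_def using openin_empty by blast
  moreover have "bdd_above S"
    using assms S by (auto intro: bdd_aboveI)
  ultimately have 1: "approximate_section X P (Sup S) a"
    and 2: "\<And>r. approximate_section X P r a \<Longrightarrow> Sup S \<le> r"
    unfolding S by (auto intro: cSup_upper cSup_least)
  then have "consistency_radius X P a = Sup S"
    unfolding consistency_radius_def by (intro Least_equality)
  then show "approximate_section X P (consistency_radius X P a) a" "consistency_radius X P a \<le> \<epsilon>"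
    using 1 2 assms by simp_all
qed

end

theory Submission
  imports Defs
begin

text \<open>If a global section s stays within r of a over every open set, it controls the
  inconsistency of a. For V \<subseteq> U, \<open>a V\<close> is within r of \<open>s V\<close>,
  which is the restriction of \<open>s U\<close>, and the Lipschitz bound puts that within K * r of
  the restriction of \<open>a U\<close>. Hence a is a (1 + K) * r-approximate section
  (\<open>approximate_section_near_global\<close>). Minimality of the consistency radius
  (\<open>consistency_radius_le\<close>) then gives \<epsilon> \<le> (1 + K) * r for every real r
  bounding the distance from s to a.\<close>

lemma approximate_section_near_global:
  assumes "pseudometric_presheaf X P"
    and lip: "\<And>U V. \<lbrakk>openin X U; openin X V; V \<subseteq> U\<rbrakk>
      \<Longrightarrow> pseudometric_lipschitz K (sections P U) (sdist P U) (sdist P V) (restr P V U)"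
    and a: "a \<in> assignments X P" and s: "s \<in> sections P (topspace X)"
    and r: "\<And>U. openin X U \<Longrightarrow> sdist P U (global_assignment X P s U) (a U) \<le> r"
  shows "approximate_section X P ((1 + K) * r) a"
  unfolding approximate_section_def
proof (intro allI impI)
  interpret pseudometric_presheaf X P by fact
  fix U V assume U: "openin X U" and V: "openin X V" and VU: "V \<subseteq> U"
  interpret V: pseudometric_space "sections P V" "sdist P V"
    by (rule pseudometric_space_sections[OF V])
  let ?s = "global_assignment X P s" and ?\<rho> = "restr P V U"
  have s_mem: "?s W \<in> sections P W" and a_mem: "a W \<in> sections P W" if "openin X W" for W
    using that a funcset_mem[OF restr_funcset[OF openin_topspace that openin_subset[OF that]] s]
    by (simp_all add: global_assignment_def assignments_def Pi_iff)
  have \<rho>_mem: "?\<rho> (a U) \<in> sections P V"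
    by (rule funcset_mem[OF restr_funcset[OF U V VU] a_mem[OF U]])
  \<comment> \<open>Functoriality makes s exactly consistent, so passing from U to V adds no error
    on its side.\<close>
  have s_restr: "?\<rho> (?s U) = ?s V"
    unfolding global_assignment_def
    using restr_comp[OF openin_topspace U V VU openin_subset[OF U] s] .
  have K: "0 \<le> K" and "sdist P V (?\<rho> (?s U)) (?\<rho> (a U)) \<le> K * sdist P U (?s U) (a U)"
    using lip[OF U V VU] s_mem[OF U] a_mem[OF U] by (simp_all add: pseudometric_lipschitz_def)
  then have "sdist P V (?s V) (?\<rho> (a U)) \<le> K * r"
    using mult_left_mono[OF r[OF U] K] by (simp add: s_restr)
  moreover have "sdist P V (a V) (?s V) \<le> r"
    using r[OF V] V.commute[OF a_mem[OF V] s_mem[OF V]] by simp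
  ultimately show "sdist P V (a V) (?\<rho> (a U)) \<le> (1 + K) * r"
    using V.triangle[OF a_mem[OF V] s_mem[OF V] \<rho>_mem] by (simp add: algebra_simps)
qed

text \<open>Here \<epsilon> is the least admissible bound: a global section is
  \<epsilon>-approximate for every \<epsilon> \<ge> 0, yet has distance 0 to itself.\<close>

theorem proposition23:
  fixes X :: "'a topology" and P :: "('a, 'b) presheaf_data"
    and a :: "'a set \<Rightarrow> 'b" and K \<epsilon> :: real
  assumes "pseudometric_presheaf X P"
    and "\<And>U V. \<lbrakk>openin X U; openin X V; V \<subseteq> U\<rbrakk>
      \<Longrightarrow> pseudometric_lipschitz K (sections P U) (sdist P U) (sdist P V) (restr P V U)"
    and "a \<in> assignments X P"
    and "approximate_section X P \<epsilon> a"
    and "\<epsilon> = consistency_radius X P a"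
  shows "\<forall>s \<in> sections P (topspace X).
    assignment_dist X P (global_assignment X P s) a \<ge> ereal (\<epsilon> / (1 + K))"
\<comment> \<open>Comparing with real upper bounds r of the distance avoids a case split: an
  infinite distance has none.\<close>
proof (rule ballI, rule ereal_le_real)
  fix s r
  assume s: "s \<in> sections P (topspace X)"
    and r: "assignment_dist X P (global_assignment X P s) a \<le> ereal r"
  have "sdist P U (global_assignment X P s U) (a U) \<le> r" if "openin X U" for U
    using r that by (simp add: assignment_dist_def SUP_le_iff)
  with assms(1-3) s have "approximate_section X P ((1 + K) * r) a"
    by (rule approximate_section_near_global)
  then have "\<epsilon> \<le> (1 + K) * r"
    unfolding assms(5) by (rule consistency_radius_le)
  \<comment> \<open>The sign of K is part of the Lipschitz condition, read off here from the
    restriction of the whole space to itself; it makes 1 + K positive for the division.\<close>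
  moreover have "0 \<le> K"
    using assms(2)[of "topspace X" "topspace X"] by (simp add: pseudometric_lipschitz_def)
  ultimately show "ereal (\<epsilon> / (1 + K)) \<le> ereal r"
    by (simp add: pos_divide_le_eq mult.commute)
qed

end
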